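(* Let $\Pi$ be a projective plane of order $q$, and assume $I(\Pi)$ admits a rank-$\le 3$ lift $F(t)=U+tV+O(t^2)$. Fix a line $\ell^*$ with points $P_1,\dots,P_{q+1}$, and for each $i$ choose a line $L_i\ne\ell^*$ through $P_i$. Set $N:=q+1$ and $V^{\triangle}:=(V_{P_i,L_j})_{1\le i,j\le N}$. Then: (1) the diagonal entries of $V^{\triangle}$ are nonzero; (2) $\mathrm{rank}_k(V^{\triangle})\le 6$; (3) if $G$ is the graph on $\{1,\dots,N\}$ in which $\{i,j\}$ (with $i\neq j$) is an edge whenever at least one of $V_{P_i,L_j}$, $V_{P_j,L_i}$ is nonzero, then $$|E(G)|\ \ge\ \frac{N(N-6)}{12}=\frac{(q+1)(q-5)}{12}.$$ In particular, at least $\frac{(q+1)(q-5)}{12}$ of the nonincidence entries $V_{P_i,L_j}$ with $i\neq j$ are nonzero.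
   Context: A projective plane $\Pi$ of order $q$ has a finite point set $P$ and line set $L$ with $|P|=|L|=q^2+q+1$; any two distinct points lie on a unique line, any two distinct lines meet in a unique point, there exist four points no three collinear, and each line contains $q+1$ points (each point lies on $q+1$ lines). Its incidence matrix $I(\Pi)\in\{0,1\}^{P\times L}$ has $I(\Pi)_{p\ell}=1$ iff $p\in\ell$. $K$ is a discretely valued field with valuation $\mathrm{val}$, uniformizer $t$ with $\mathrm{val}(t)=1$, and residue field $k$ identified with a coefficient subfield of the valuation ring (e.g. $K=k((t))$). A rank-$\le 3$ lift of $I(\Pi)$ is a matrix $F\in K^{P\times L}$ of rank at most $3$ over $K$ with $\mathrm{val}(F_{p\ell})=I(\Pi)_{p\ell}$ entrywise (valuation $1$ at incidences, $0$ at nonincidences). Its entrywise expansion is written $F=U+tV+O(t^2)$ with $U,V\in k^{P\times L}$, where $O(t^2)$ denotes a matrix with entries of valuation at least $2$. *)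

theory Defs
  imports "HOL-Analysis.Analysis" "HOL-Library.Extended"
begin

section \<open>Projective planes\<close>

text \<open>
  The finite point set and line set are the universes of the types \<open>'p\<close> and \<open>'l\<close>, so that
  matrices indexed by points and lines are elements of \<open>'a ^ 'l ^ 'p\<close> (rows are points).
\<close>

locale projective_plane =
  fixes inc :: "'p::finite \<Rightarrow> 'l::finite \<Rightarrow> bool"
    and q :: nat
  assumes card_points: "CARD('p) = q\<^sup>2 + q + 1"
    and card_lines: "CARD('l) = q\<^sup>2 + q + 1"
    and unique_line: "x \<noteq> y \<Longrightarrow> \<exists>!l. inc x l \<and> inc y l"
    and unique_point: "l \<noteq> m \<Longrightarrow> \<exists>!x. inc x l \<and> inc x m"
    and quadrangle: "\<exists>S. card S = 4 \<and> (\<forall>T\<subseteq>S. card T = 3 \<longrightarrow> \<not> (\<exists>l. \<forall>x\<in>T. inc x l))"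
    and points_on_line: "card {x. inc x l} = q + 1"
    and lines_through_point: "card {l. inc x l} = q + 1"

definition incidence_matrix :: "('p::finite \<Rightarrow> 'l::finite \<Rightarrow> bool) \<Rightarrow> int ^ 'l ^ 'p" where
  "incidence_matrix inc = (\<chi> x l. if inc x l then 1 else 0)"


section \<open>Discretely valued fields with a coefficient field\<close>

text \<open>
  A normalized discrete valuation takes values in the integers together with \<open>Pinf\<close>. The value
  \<open>Minf\<close>, which the type \<^typ>\<open>int extended\<close> also contains, is excluded by \<open>val_not_Minf\<close>.
  Completeness is not required.
\<close>

locale discretely_valued_field =
  fixes val :: "'a::field \<Rightarrow> int extended"
    and t :: 'a
  assumes val_not_Minf: "val x \<noteq> Minf"
    and val_Pinf_iff: "val x = Pinf \<longleftrightarrow> x = 0"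
    and val_mult: "val (x * y) = val x + val y"
    and val_add: "val (x + y) \<ge> min (val x) (val y)"
    and val_uniformizer: "val t = Fin 1"

text \<open>
  The residue field \<open>k\<close>, identified with a coefficient subfield of the valuation ring, is a field
  type \<open>'k\<close> with a ring homomorphism \<open>\<iota>\<close> into the valuation ring whose composition with the
  residue map is bijective: \<open>\<iota>_residue\<close> is surjectivity, and injectivity is automatic for a
  homomorphism of fields.
\<close>

locale valued_field_with_coefficient_field = discretely_valued_field val t
  for val :: "'a::field \<Rightarrow> int extended" and t :: 'a +
  fixes \<iota> :: "'k::field \<Rightarrow> 'a"
  assumes \<iota>_one: "\<iota> 1 = 1"
    and \<iota>_add: "\<iota> (c + d) = \<iota> c + \<iota> d"
    and \<iota>_mult: "\<iota> (c * d) = \<iota> c * \<iota> d"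
    and \<iota>_integral: "val (\<iota> c) \<ge> Fin 0"
    and \<iota>_residue: "val x \<ge> Fin 0 \<Longrightarrow> \<exists>c. val (x - \<iota> c) > Fin 0"


section \<open>Lifts and their expansions\<close>

definition rank_le_3_lift ::
  "('p::finite \<Rightarrow> 'l::finite \<Rightarrow> bool) \<Rightarrow> ('a::field \<Rightarrow> int extended) \<Rightarrow> 'a ^ 'l ^ 'p \<Rightarrow> bool" where
  "rank_le_3_lift inc val F \<longleftrightarrow>
     rank F \<le> 3 \<and> (\<forall>x l. val (F $ x $ l) = Fin (incidence_matrix inc $ x $ l))"

text \<open>The relation \<open>F = U + t V + O(t\<^sup>2)\<close>, for matrices \<open>U\<close> and \<open>V\<close> over the coefficient field.\<close>

definition first_order_expansion ::
  "('a::field \<Rightarrow> int extended) \<Rightarrow> 'a \<Rightarrow> ('k::field \<Rightarrow> 'a) \<Rightarrow>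
   'a ^ 'l::finite ^ 'p::finite \<Rightarrow> 'k ^ 'l ^ 'p \<Rightarrow> 'k ^ 'l ^ 'p \<Rightarrow> bool" where
  "first_order_expansion val t \<iota> F U V \<longleftrightarrow>
     (\<forall>x l. val (F $ x $ l - (\<iota> (U $ x $ l) + t * \<iota> (V $ x $ l))) \<ge> Fin 2)"


section \<open>Selected square submatrices and their support graphs\<close>

definition selected_submatrix ::
  "'k ^ 'l::finite ^ 'p::finite \<Rightarrow> ('n::finite \<Rightarrow> 'p) \<Rightarrow> ('n \<Rightarrow> 'l) \<Rightarrow> 'k ^ 'n ^ 'n" where
  "selected_submatrix V P L = (\<chi> i j. V $ P i $ L j)"

definition support_graph_edges :: "'k::zero ^ 'n::finite ^ 'n \<Rightarrow> 'n set set" where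
  "support_graph_edges A = {{i, j} | i j. i \<noteq> j \<and> (A $ i $ j \<noteq> 0 \<or> A $ j $ i \<noteq> 0)}"

end

theory Submission
  imports Defs
begin

text \<open>
  Gaussian elimination over the valuation ring, always pivoting on an entry of minimal valuation,
  writes \<open>F\<close> as a sum of three products of an integral column and an integral row. Expanding
  these factors to first order gives \<open>V = A\<^sub>0 B\<^sub>1 + A\<^sub>1 B\<^sub>0\<close> with inner dimension \<open>3\<close>, so
  \<open>V\<close> has rank at most \<open>6\<close>. An independent set of \<open>G\<close> selects a diagonal submatrix of
  \<open>V\<^sup>\<triangle>\<close> with nonzero diagonal, hence has at most \<open>6\<close> vertices, and a Turan-type bound
  turns this into a lower bound for the number of edges.
\<close>

section \<open>Rank\<close>

text \<open>Every row of \<open>A\<close> is a combination of the vectors \<open>b s\<close>, of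
  which there are at most \<open>card I\<close>.\<close>

lemma rank_le_card_if_sum_rank_one:
  fixes A :: "'a::field ^ 'n::finite ^ 'm::finite"
  assumes "finite I" and A: "\<And>i j. A $ i $ j = (\<Sum>s\<in>I. a s i * b s j)"
  shows "rank A \<le> card I"
proof -
  let ?B = "(\<lambda>s. \<chi> j. b s j) ` I"
  have "row i A \<in> vec.span ?B" for i
  proof -
    have "row i A = (\<Sum>s\<in>I. a s i *s (\<chi> j. b s j))"
      by (simp add: vec_eq_iff row_def A)
    also have "\<dots> \<in> vec.span ?B"
      by (intro vec.span_sum vec.span_scale vec.span_base) auto
    finally show ?thesis .
  qed
  then have "rows A \<subseteq> vec.span ?B"
    by (auto simp: rows_def)
  then have "rank A \<le> card ?B"
    unfolding row_rank_def_gen using assms(1) by (intro vec.dim_le_card) auto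
  also have "\<dots> \<le> card I"
    using assms(1) by (rule card_image_le)
  finally show ?thesis .
qed

text \<open>The rows indexed by \<open>S\<close> are independent: reading a vanishing combination at
  coordinate \<open>k\<close> in \<open>S\<close> leaves only the term of row \<open>k\<close>.
  Entries in columns outside \<open>S\<close> are arbitrary.\<close>

lemma card_le_rank_if_diagonal_on:
  fixes A :: "'a::field ^ 'n::finite ^ 'n"
  assumes diag: "\<And>i. i \<in> S \<Longrightarrow> A $ i $ i \<noteq> 0"
    and off: "\<And>i j. i \<in> S \<Longrightarrow> j \<in> S \<Longrightarrow> i \<noteq> j \<Longrightarrow> A $ i $ j = 0"
  shows "card S \<le> rank A"
proof -
  have inj: "inj_on (\<lambda>i. row i A) S"
  proof (rule inj_onI)
    fix i j
    assume ij: "i \<in> S" "j \<in> S" "row i A = row j A"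
    then have "A $ i $ i = A $ j $ i"
      by (simp add: row_def vec_eq_iff)
    then show "i = j"
      using diag[OF ij(1)] off[OF ij(2,1)] by auto
  qed
  have "vec.independent ((\<lambda>i. row i A) ` S)"
  proof (rule vec.independent_if_scalars_zero)
    fix f x
    assume zero: "(\<Sum>x\<in>(\<lambda>i. row i A) ` S. f x *s x) = 0" and "x \<in> (\<lambda>i. row i A) ` S"
    then obtain k where k: "k \<in> S" "x = row k A"
      by auto
    have "0 = (\<Sum>i\<in>S. f (row i A) *s row i A) $ k"
      using zero by (simp add: sum.reindex[OF inj])
    also have "\<dots> = (\<Sum>i\<in>S. f (row i A) * A $ i $ k)"
      by (simp add: row_def)
    also have "\<dots> = (\<Sum>i\<in>S. if i = k then f (row k A) * A $ k $ k else 0)"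
      using k(1) off by (intro sum.cong) auto
    also have "\<dots> = f (row k A) * A $ k $ k"
      using k(1) by simp
    finally show "f x = 0"
      using diag[OF k(1)] k(2) by simp
  qed simp
  then have "card ((\<lambda>i. row i A) ` S) \<le> rank A"
    unfolding row_rank_def_gen by (intro vec.independent_card_le_dim) (auto simp: rows_def)
  then show ?thesis
    by (simp add: card_image[OF inj])
qed

text \<open>The drop is strict because the new rows stay in the old row space and vanish at column
  \<open>j0\<close>, whereas the pivot row does not vanish there.\<close>

lemma rank_eliminate_less:
  fixes M :: "'a::field ^ 'n::finite ^ 'm::finite"
  assumes pivot: "M $ i0 $ j0 \<noteq> 0"
    and M': "\<And>i j. M' $ i $ j = M $ i $ j - M $ i $ j0 / M $ i0 $ j0 * M $ i0 $ j"
  shows "rank M' < rank M"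
proof -
  have row_M': "row i M' = row i M - (M $ i $ j0 / M $ i0 $ j0) *s row i0 M" for i
    by (simp add: vec_eq_iff row_def M')
  have in_M: "row i M \<in> vec.span (rows M)" for i
    by (intro vec.span_base) (auto simp: rows_def)
  have "rows M' \<subseteq> vec.span (rows M)"
    unfolding rows_def[of M'] row_M' by (auto intro!: vec.span_diff vec.span_scale in_M)
  then have sub: "vec.span (rows M') \<subseteq> vec.span (rows M)"
    by (intro vec.span_minimal) auto
  have "vec.span (rows M') \<subseteq> {v. v $ j0 = 0}"
    using pivot
    by (intro vec.span_minimal) (auto simp: rows_def row_def M' vec.subspace_def)
  then have "row i0 M \<notin> vec.span (rows M')"
    using pivot by (auto simp: row_def)
  with sub in_M have "vec.span (rows M') \<subset> vec.span (rows M)"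
    by blast
  then show ?thesis
    unfolding row_rank_def_gen by (rule vec.dim_psubset)
qed

section \<open>Integral rank factorizations and first-order expansions\<close>

context discretely_valued_field
begin

lemma val_one: "val 1 = Fin 0"
  using val_mult[of 1 1] val_Pinf_iff[of 1] val_not_Minf[of 1] by (cases "val 1") auto

lemma val_zero: "val 0 = Pinf"
  by (simp add: val_Pinf_iff)

lemma val_mult_ge: "val x \<ge> Fin m \<Longrightarrow> val y \<ge> Fin n \<Longrightarrow> val (x * y) \<ge> Fin (m + n)"
  unfolding val_mult by (cases "val x"; cases "val y") simp_all

lemma val_add_ge: "val x \<ge> c \<Longrightarrow> val y \<ge> c \<Longrightarrow> val (x + y) \<ge> c"
  using val_add[of x y] by (meson min.boundedI order_trans)

lemma val_minus: "val (- x) = val x"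
proof -
  have "val (- 1) + val (- 1) = Fin 0"
    using val_mult[of "-1" "-1"] val_one by simp
  then have "val (- 1) = Fin 0"
    by (cases "val (- 1)") auto
  then show ?thesis
    using val_mult[of "-1" x] by (cases "val x") auto
qed

lemma val_diff_ge: "val x \<ge> c \<Longrightarrow> val y \<ge> c \<Longrightarrow> val (x - y) \<ge> c"
  using val_add_ge[of c x "- y"] by (simp add: val_minus)

lemma val_divide_ge:
  assumes "y \<noteq> 0" "val y = Fin n" "val x \<ge> Fin (m + n)"
  shows "val (x / y) \<ge> Fin m"
  using val_mult[of "x / y" y] val_not_Minf[of "x / y"] assms by (cases "val (x / y)") auto

text \<open>Each elimination step splits off one rank-one term and lowers the rank. A pivot of
  minimal valuation makes all multipliers integral, so the remaining matrix is again
  integral.\<close>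

lemma integral_rank_factorization:
  fixes M :: "'a ^ 'n::finite ^ 'm::finite"
  assumes "rank M \<le> r" and "\<And>i j. val (M $ i $ j) \<ge> Fin 0"
  shows "\<exists>a b. (\<forall>s i. val (a s i) \<ge> Fin 0) \<and> (\<forall>s j. val (b s j) \<ge> Fin 0) \<and>
    (\<forall>i j. M $ i $ j = (\<Sum>s<r. a s i * b s j))"
  using assms
proof (induction r arbitrary: M)
  case (0 M)
  \<comment> \<open>A nonzero entry could serve as a pivot and would produce a matrix of rank below
    \<open>0\<close>.\<close>
  have "M $ i $ j = 0" for i j
    using rank_eliminate_less[of M i j "\<chi> k l. M $ k $ l - M $ k $ j / M $ i $ j * M $ i $ l"]
      "0.prems"(1) by auto
  then show ?case
    by (intro exI[of _ "\<lambda>_ _. 0"]) (simp add: val_zero)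
next
  case (Suc r M)
  show ?case
  proof (cases "M = 0")
    case True
    then show ?thesis
      by (intro exI[of _ "\<lambda>_ _. 0"]) (simp add: val_zero)
  next
    case False
    obtain i0 j0 where min: "\<And>i j. val (M $ i0 $ j0) \<le> val (M $ i $ j)"
    proof -
      obtain p where "\<forall>p'. \<not> val (M $ fst p' $ snd p') < val (M $ fst p $ snd p)"
        using ex_is_arg_min_if_finite[of UNIV "\<lambda>p. val (M $ fst p $ snd p)"]
        by (auto simp: is_arg_min_def)
      then show ?thesis
        using that[of "fst p" "snd p"] by (metis fst_conv snd_conv not_less)
    qed
    have pivot: "M $ i0 $ j0 \<noteq> 0"
      using min False by (auto simp: vec_eq_iff val_zero val_Pinf_iff)
    obtain n where n: "val (M $ i0 $ j0) = Fin n"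
      using pivot val_not_Minf val_Pinf_iff by (cases "val (M $ i0 $ j0)") auto
    define c where "c i = M $ i $ j0 / M $ i0 $ j0" for i
    define M' where "M' = (\<chi> i j. M $ i $ j - c i * M $ i0 $ j)"
    have c: "val (c i) \<ge> Fin 0" for i
      unfolding c_def using min[of i j0] n pivot by (intro val_divide_ge) auto
    have int_M': "val (M' $ i $ j) \<ge> Fin 0" for i j
      using val_diff_ge[OF Suc.prems(2) val_mult_ge[OF c Suc.prems(2), of i i0 j, simplified]]
      by (simp add: M'_def)
    have "rank M' < rank M"
      using pivot by (rule rank_eliminate_less) (simp add: M'_def c_def)
    with Suc.prems(1) have "rank M' \<le> r"
      by simp
    from Suc.IH[OF this int_M'] obtain a b
      where ab: "\<And>s i. val (a s i) \<ge> Fin 0" "\<And>s j. val (b s j) \<ge> Fin 0"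
        "\<And>i j. M' $ i $ j = (\<Sum>s<r. a s i * b s j)"
      by blast
    \<comment> \<open>The new index \<open>r\<close> carries the column of multipliers and the pivot
      row; the indices below \<open>r\<close> carry the factorization of \<open>M'\<close>.\<close>
    have M: "M $ i $ j = (\<Sum>s<Suc r. (a(r := c)) s i * (b(r := \<lambda>j. M $ i0 $ j)) s j)" for i j
    proof -
      have "(\<Sum>s<r. (a(r := c)) s i * (b(r := \<lambda>j. M $ i0 $ j)) s j) = M' $ i $ j"
        by (auto simp: ab(3) intro!: sum.cong)
      then show ?thesis
        by (simp add: M'_def)
    qed
    have "val ((a(r := c)) s i) \<ge> Fin 0" "val ((b(r := \<lambda>j. M $ i0 $ j)) s j) \<ge> Fin 0" for s i j
      using ab(1,2) c Suc.prems(2) by auto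
    with M show ?thesis
      by blast
  qed
qed

end

section \<open>First-order expansions over the coefficient field\<close>

context valued_field_with_coefficient_field
begin

text \<open>The pair \<open>(c, d)\<close> represents \<open>x\<close> modulo \<open>t * t\<close>;
  \<open>first_order_expansion\<close> is this relation in every entry.\<close>

definition has_jet :: "'a \<Rightarrow> 'k \<Rightarrow> 'k \<Rightarrow> bool" where
  "has_jet x c d \<longleftrightarrow> val (x - (\<iota> c + t * \<iota> d)) \<ge> Fin 2"

lemma \<iota>_zero: "\<iota> 0 = 0"
  using \<iota>_add[of 0 0] by (metis add_cancel_right_right)

lemma \<iota>_diff: "\<iota> (c - d) = \<iota> c - \<iota> d"
  using \<iota>_add[of "c - d" d] by simp

text \<open>The valuations of \<open>\<iota> c\<close> and \<open>\<iota> (inverse c)\<close> are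
  both nonnegative and sum to \<open>0\<close>.\<close>

lemma val_\<iota>:
  assumes "c \<noteq> 0"
  shows "val (\<iota> c) = Fin 0"
proof -
  have "val (\<iota> c) + val (\<iota> (inverse c)) = Fin 0"
    using assms val_one by (simp add: \<iota>_one flip: val_mult \<iota>_mult)
  then show ?thesis
    using \<iota>_integral[of c] \<iota>_integral[of "inverse c"]
    by (cases "val (\<iota> c)"; cases "val (\<iota> (inverse c))") auto
qed

lemma t_nonzero: "t \<noteq> 0"
  using val_uniformizer val_zero by auto

lemma val_t_mult_\<iota>: "val (t * \<iota> d) \<ge> Fin 1"
  using val_mult_ge[OF _ \<iota>_integral, of 1 t d] val_uniformizer by simp

lemma has_jet_zero: "has_jet 0 0 0"
  by (simp add: has_jet_def \<iota>_zero val_zero)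

lemma has_jet_add:
  assumes "has_jet x c d" "has_jet y c' d'"
  shows "has_jet (x + y) (c + c') (d + d')"
  using val_add_ge[OF assms[unfolded has_jet_def]]
  by (simp add: has_jet_def \<iota>_add algebra_simps)

lemma has_jet_diff:
  assumes "has_jet x c d" "has_jet y c' d'"
  shows "has_jet (x - y) (c - c') (d - d')"
  using val_diff_ge[OF assms[unfolded has_jet_def]]
  by (simp add: has_jet_def \<iota>_diff algebra_simps)

text \<open>This is multiplication of dual numbers. The error consists of
  \<open>(x - ?u) * y\<close>, \<open>?u * (y - ?u')\<close> and the product of the two linear
  terms, each of valuation at least \<open>2\<close>.\<close>

lemma has_jet_mult:
  assumes "has_jet x c d" "has_jet y c' d'" "val y \<ge> Fin 0"
  shows "has_jet (x * y) (c * c') (c * d' + d * c')"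
proof -
  let ?u = "\<iota> c + t * \<iota> d" and ?u' = "\<iota> c' + t * \<iota> d'"
  have u: "val ?u \<ge> Fin 0"
    using val_t_mult_\<iota>[of d] \<iota>_integral[of c] by (intro val_add_ge) (auto elim: order_trans[rotated])
  have "val ((x - ?u) * y) \<ge> Fin 2" "val (?u * (y - ?u')) \<ge> Fin 2"
    "val ((t * \<iota> d) * (t * \<iota> d')) \<ge> Fin 2"
    using val_mult_ge[OF assms(1)[unfolded has_jet_def] assms(3)]
      val_mult_ge[OF u assms(2)[unfolded has_jet_def]]
      val_mult_ge[OF val_t_mult_\<iota> val_t_mult_\<iota>] by simp_all
  then have "val ((x - ?u) * y + ?u * (y - ?u') + (t * \<iota> d) * (t * \<iota> d')) \<ge> Fin 2"
    by (intro val_add_ge)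
  also have "(x - ?u) * y + ?u * (y - ?u') + (t * \<iota> d) * (t * \<iota> d')
      = x * y - (\<iota> (c * c') + t * \<iota> (c * d' + d * c'))"
    by (simp add: \<iota>_add \<iota>_mult algebra_simps)
  finally show ?thesis
    by (simp add: has_jet_def)
qed

lemma has_jet_sum:
  "(\<And>s. s \<in> I \<Longrightarrow> has_jet (x s) (c s) (d s)) \<Longrightarrow>
    has_jet (\<Sum>s\<in>I. x s) (\<Sum>s\<in>I. c s) (\<Sum>s\<in>I. d s)"
  by (induction I rule: infinite_finite_induct) (auto intro: has_jet_zero has_jet_add)

text \<open>One digit of the \<open>t\<close>-adic expansion: valuations are integers, so a positive
  one is at least \<open>1\<close> and survives division by \<open>t\<close>.\<close>

lemma residue_decomposition:
  assumes "val x \<ge> Fin 0"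
  obtains c y where "x = \<iota> c + t * y" "val y \<ge> Fin 0"
proof -
  obtain c where "val (x - \<iota> c) > Fin 0"
    using \<iota>_residue[OF assms] by blast
  then have "val (x - \<iota> c) \<ge> Fin (0 + 1)"
    by (cases "val (x - \<iota> c)") auto
  then have "val ((x - \<iota> c) / t) \<ge> Fin 0"
    by (rule val_divide_ge[OF t_nonzero val_uniformizer])
  then show ?thesis
    using that[of c "(x - \<iota> c) / t"] t_nonzero by simp
qed

lemma integral_has_jet:
  assumes "val x \<ge> Fin 0"
  shows "\<exists>c d. has_jet x c d"
proof -
  obtain c y where y: "x = \<iota> c + t * y" "val y \<ge> Fin 0"
    using residue_decomposition[OF assms] .
  obtain d z where z: "y = \<iota> d + t * z" "val z \<ge> Fin 0"
    using residue_decomposition[OF y(2)] .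
  have "val (t * t) \<ge> Fin 2"
    by (simp add: val_mult val_uniformizer)
  from val_mult_ge[OF this z(2)] have "has_jet x c d"
    by (simp add: has_jet_def y(1) z(1) algebra_simps)
  then show ?thesis
    by blast
qed

text \<open>A nonzero \<open>c\<close> would make \<open>\<iota> c\<close> a unit, yet it is a
  combination of terms of valuation at least \<open>1\<close>.\<close>

lemma has_jet_constant_term_zero:
  assumes "has_jet x c d" "val x \<ge> Fin 1"
  shows "c = 0"
proof (rule ccontr)
  assume "c \<noteq> 0"
  have "val (x - (\<iota> c + t * \<iota> d)) \<ge> Fin 1"
    using assms(1) by (auto simp: has_jet_def elim: order_trans[rotated])
  from val_diff_ge[OF val_diff_ge[OF assms(2) this] val_t_mult_\<iota>[of d]]
  show False
    using val_\<iota>[OF \<open>c \<noteq> 0\<close>] by simp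
qed

lemma has_jet_linear_term_zero_iff:
  assumes "has_jet x 0 d"
  shows "d = 0 \<longleftrightarrow> val x \<ge> Fin 2"
proof
  assume "d = 0"
  then show "val x \<ge> Fin 2"
    using assms by (simp add: has_jet_def \<iota>_zero)
next
  assume "val x \<ge> Fin 2"
  from val_diff_ge[OF this assms[unfolded has_jet_def]] have "val (t * \<iota> d) \<ge> Fin 2"
    by (simp add: \<iota>_zero)
  then show "d = 0"
    using val_\<iota>[of d] by (cases "d = 0") (auto simp: val_mult val_uniformizer)
qed

text \<open>The difference of two jets of \<open>x\<close> is a jet of \<open>0\<close>, whose
  constant and then linear terms must vanish.\<close>

lemma has_jet_unique:
  assumes "has_jet x c d" "has_jet x c' d'"
  shows "c = c'" "d = d'"
proof -
  have jet: "has_jet 0 (c - c') (d - d')"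
    using has_jet_diff[OF assms] by simp
  then have *: "c - c' = 0"
    by (rule has_jet_constant_term_zero) (simp add: val_zero)
  have "d - d' = 0"
    using jet has_jet_linear_term_zero_iff[of 0 "d - d'"] * by (simp add: val_zero)
  with * show "c = c'" "d = d'"
    by simp_all
qed

lemma has_jet_linear_term_nonzero:
  assumes "has_jet x c d" "val x = Fin 1"
  shows "d \<noteq> 0"
proof -
  have "c = 0"
    using has_jet_constant_term_zero[OF assms(1)] assms(2) by simp
  then show ?thesis
    using has_jet_linear_term_zero_iff[of x d] assms by simp
qed

text \<open>By the product rule each of the \<open>r\<close> integral products contributes two
  rank-one terms to the linear coefficient; uniqueness of jets identifies the result with
  \<open>V\<close>. The disjoint sum indexes these \<open>2 * r\<close> terms.\<close>

lemma linear_term_rank_factorization: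
  fixes F :: "'a ^ 'n::finite ^ 'm::finite"
  assumes "rank F \<le> r" "\<And>i j. val (F $ i $ j) \<ge> Fin 0"
    and exp: "first_order_expansion val t \<iota> F U V"
  obtains a b where "\<And>i j. V $ i $ j = (\<Sum>s\<in>{..<r} <+> {..<r}. a s i * b s j)"
proof -
  obtain x y where xy: "\<And>s i. val (x s i) \<ge> Fin 0" "\<And>s j. val (y s j) \<ge> Fin 0"
    "\<And>i j. F $ i $ j = (\<Sum>s<r. x s i * y s j)"
    using integral_rank_factorization[OF assms(1,2)] by blast
  obtain x0 x1 where x: "\<And>s i. has_jet (x s i) (x0 s i) (x1 s i)"
    using integral_has_jet[OF xy(1)] by metis
  obtain y0 y1 where y: "\<And>s j. has_jet (y s j) (y0 s j) (y1 s j)"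
    using integral_has_jet[OF xy(2)] by metis
  have "V $ i $ j = (\<Sum>s<r. x0 s i * y1 s j + x1 s i * y0 s j)" for i j
  proof (rule has_jet_unique(2))
    show "has_jet (F $ i $ j) (U $ i $ j) (V $ i $ j)"
      using exp by (simp add: first_order_expansion_def has_jet_def)
    show "has_jet (F $ i $ j) (\<Sum>s<r. x0 s i * y0 s j) (\<Sum>s<r. x0 s i * y1 s j + x1 s i * y0 s j)"
      unfolding xy(3) by (intro has_jet_sum has_jet_mult x y xy)
  qed
  then show ?thesis
    \<comment> \<open>The second pair is swapped so that constant terms meet linear terms.\<close>
    by (intro that[of "case_sum x0 x1" "case_sum y1 y0"])
      (simp add: sum.Plus sum.distrib)
qed

end

section \<open>Edges and independent sets\<close>

text \<open>Peel off a maximal independent set \<open>S\<close>: every vertex of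
  \<open>W - S\<close> sends an edge into \<open>S\<close>, and induction bounds the edges inside
  \<open>W - S\<close>. Subtraction is over the reals, so the bound is trivial when
  \<open>card W\<close> is at most \<open>a\<close>.\<close>

lemma edge_bound_of_independence_number:
  fixes E :: "'v set set"
  assumes "finite W" and E: "\<And>e. e \<in> E \<Longrightarrow> card e = 2"
    and indep: "\<And>S. S \<subseteq> W \<Longrightarrow> \<forall>e\<in>E. \<not> e \<subseteq> S \<Longrightarrow> card S \<le> a"
  shows "real (card W) * (real (card W) - real a) \<le> 2 * real a * real (card {e \<in> E. e \<subseteq> W})"
  using assms(1) indep
proof (induction W rule: finite_psubset_induct)
  case (psubset W)
  show ?case
  proof (cases "W = {}")
    case False
    then obtain w where "w \<in> W"
      by blast
    let ?I = "{S. S \<subseteq> W \<and> (\<forall>e\<in>E. \<not> e \<subseteq> S)}"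
    have single: "\<not> e \<subseteq> {v}" if "e \<in> E" for e v
      using card_mono[of "{v}" e] E[OF that] by auto
    then have "{w} \<in> ?I"
      using \<open>w \<in> W\<close> by auto
    \<comment> \<open>Starting from \<open>{w}\<close> keeps \<open>S\<close> nonempty, so that
      \<open>W - S\<close> is strictly smaller.\<close>
    then obtain S where S: "S \<in> ?I" "{w} \<subseteq> S" and max: "\<forall>T\<in>?I. S \<subseteq> T \<longrightarrow> S = T"
      using finite_has_maximal2[of ?I "{w}"] psubset.hyps by auto
    have fin: "finite S" "finite (W - S)"
      using S psubset.hyps finite_subset by auto
    have "\<exists>e\<in>E. e \<subseteq> insert v S" if "v \<in> W - S" for v
    proof (rule ccontr)
      assume "\<not> (\<exists>e\<in>E. e \<subseteq> insert v S)"
      then have "insert v S \<in> ?I"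
        using that S(1) by blast
      then have "S = insert v S"
        using max subset_insertI by blast
      then show False
        using that by blast
    qed
    then obtain f where f: "\<And>v. v \<in> W - S \<Longrightarrow> f v \<in> E" "\<And>v. v \<in> W - S \<Longrightarrow> f v \<subseteq> insert v S"
      by metis
    have v_in: "v \<in> f v" if "v \<in> W - S" for v
      using f[OF that] S(1) by blast
    \<comment> \<open>The edge \<open>f v\<close> has \<open>v\<close> as its only vertex outside
      \<open>S\<close>, which recovers \<open>v\<close>.\<close>
    have "inj_on f (W - S)"
    proof (rule inj_onI)
      fix v w
      assume vw: "v \<in> W - S" "w \<in> W - S" "f v = f w"
      then have "v \<in> insert w S"
        using v_in[OF vw(1)] f(2)[OF vw(2)] by auto
      then show "v = w"
        using vw(1) by blast
    qed
    then have card_f: "card (f ` (W - S)) = card (W - S)"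
      by (rule card_image)
    \<comment> \<open>An edge inside \<open>W - S\<close> equal to \<open>f v\<close> would be
      contained in \<open>{v}\<close>.\<close>
    have "f v \<noteq> e" if "v \<in> W - S" "e \<subseteq> W - S" for v e
      using single[OF f(1)[OF that(1)], of v] f(2)[OF that(1)] that(2) by blast
    then have disj: "f ` (W - S) \<inter> {e \<in> E. e \<subseteq> W - S} = {}"
      by auto
    have sub: "f ` (W - S) \<union> {e \<in> E. e \<subseteq> W - S} \<subseteq> {e \<in> E. e \<subseteq> W}"
    proof -
      have "insert v S \<subseteq> W" if "v \<in> W - S" for v
        using that S(1) by blast
      then show ?thesis
        using f by blast
    qed
    have "card (W - S) + card {e \<in> E. e \<subseteq> W - S} \<le> card {e \<in> E. e \<subseteq> W}"
    proof -
      have "finite {e \<in> E. e \<subseteq> W}" "finite {e \<in> E. e \<subseteq> W - S}"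
        using psubset.hyps by auto
      then show ?thesis
        using card_mono[OF _ sub] card_Un_disjoint[OF _ _ disj] fin card_f by simp
    qed
    then have edges: "real (card (W - S)) + real (card {e \<in> E. e \<subseteq> W - S})
        \<le> real (card {e \<in> E. e \<subseteq> W})"
      by linarith
    have "W - S \<subset> W"
      using S \<open>w \<in> W\<close> by auto
    then have IH: "real (card (W - S)) * (real (card (W - S)) - real a)
        \<le> 2 * real a * real (card {e \<in> E. e \<subseteq> W - S})"
      by (rule psubset.IH) (rule psubset.prems; blast)
    have s: "real (card S) \<le> real a"
      using S(1) psubset.prems[of S] by simp
    have n: "real (card (W - S)) = real (card W) - real (card S)" "card S \<le> card W"
      using S psubset.hyps card_mono[of W S] fin by (auto simp: card_Diff_subset)
    \<comment> \<open>The right side equals the term bounded by induction plus \<open>2 * a\<close>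
      for each of the \<open>card (W - S)\<close> new edges.\<close>
    have "real (card W) * (real (card W) - real a)
        \<le> (real (card W) - real (card S)) * (real (card W) - real (card S) + real a)"
    proof -
      have "(real (card W) - real (card S)) * (real (card W) - real (card S) + real a)
          - real (card W) * (real (card W) - real a)
        = (real a - real (card S)) * (2 * real (card W) - real (card S))"
        by (simp add: algebra_simps)
      moreover have "\<dots> \<ge> 0"
        using s n by (intro mult_nonneg_nonneg) auto
      ultimately show ?thesis
        by linarith
    qed
    also have "\<dots> = real (card (W - S)) * (real (card (W - S)) - real a)
        + 2 * real a * real (card (W - S))"
      by (simp add: n(1) algebra_simps)
    also have "\<dots> \<le> 2 * real a * (real (card (W - S)) + real (card {e \<in> E. e \<subseteq> W - S}))"
      using IH by (simp add: algebra_simps)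
    also have "\<dots> \<le> 2 * real a * real (card {e \<in> E. e \<subseteq> W})"
      using edges by (intro mult_left_mono) auto
    finally show ?thesis .
  qed simp
qed

lemma card_support_graph_edges_ge:
  fixes A :: "'a::field ^ 'n::finite ^ 'n"
  assumes diag: "\<And>i. A $ i $ i \<noteq> 0" and rank: "rank A \<le> a"
  shows "real CARD('n) * (real CARD('n) - real a) \<le> 2 * real a * real (card (support_graph_edges A))"
proof -
  have "card S \<le> a" if "\<forall>e\<in>support_graph_edges A. \<not> e \<subseteq> S" for S
  proof -
    have "A $ i $ j = 0" if "i \<in> S" "j \<in> S" "i \<noteq> j" for i j
      using \<open>\<forall>e\<in>support_graph_edges A. \<not> e \<subseteq> S\<close> that by (auto simp: support_graph_edges_def)
    then show ?thesis
      using card_le_rank_if_diagonal_on[of S A] diag rank by simp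
  qed
  moreover have "card e = 2" if "e \<in> support_graph_edges A" for e
    using that by (auto simp: support_graph_edges_def)
  ultimately show ?thesis
    using edge_bound_of_independence_number[of UNIV "support_graph_edges A" a] by simp
qed

text \<open>Forgetting the order of the indices maps the nonzero off-diagonal positions onto the
  edges.\<close>

lemma card_support_graph_edges_le:
  fixes A :: "'a::zero ^ 'n::finite ^ 'n"
  shows "card (support_graph_edges A) \<le> card {(i, j). i \<noteq> j \<and> A $ i $ j \<noteq> 0}"
proof -
  have "support_graph_edges A \<subseteq> (\<lambda>(i, j). {i, j}) ` {(i, j). i \<noteq> j \<and> A $ i $ j \<noteq> 0}"
    by (auto simp: support_graph_edges_def image_iff)
  then show ?thesis
    by (rule surj_card_le[rotated]) simp
qed

theorem theorem5p12:
  fixes inc :: "'p::finite \<Rightarrow> 'l::finite \<Rightarrow> bool"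
    and q N :: nat
    and val :: "'a::field \<Rightarrow> int extended"
    and t :: 'a
    and \<iota> :: "'k::field \<Rightarrow> 'a"
    and F :: "'a ^ 'l ^ 'p"
    and U V :: "'k ^ 'l ^ 'p"
    and lstar :: 'l
    and P :: "'n::finite \<Rightarrow> 'p"
    and L :: "'n \<Rightarrow> 'l"
    and Vtri :: "'k ^ 'n ^ 'n"
  assumes plane: "projective_plane inc q"
    and valued: "valued_field_with_coefficient_field val t \<iota>"
    and lift: "rank_le_3_lift inc val F"
    and expansion: "first_order_expansion val t \<iota> F U V"
    and N: "N = q + 1" "CARD('n) = N"
    and points: "bij_betw P UNIV {x. inc x lstar}"
    and lines: "\<And>i. L i \<noteq> lstar" "\<And>i. inc (P i) (L i)"
    and Vtri: "Vtri = selected_submatrix V P L"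
  shows "(\<forall>i. Vtri $ i $ i \<noteq> 0)
    \<and> rank Vtri \<le> 6
    \<and> real (card (support_graph_edges Vtri)) \<ge> real N * (real N - 6) / 12
    \<and> real N * (real N - 6) / 12 = (real q + 1) * (real q - 5) / 12
    \<and> (\<forall>i j. i \<noteq> j \<longrightarrow> \<not> inc (P i) (L j))
    \<and> real (card {(i, j). i \<noteq> j \<and> V $ P i $ L j \<noteq> 0}) \<ge> (real q + 1) * (real q - 5) / 12"
proof -
  interpret projective_plane inc q by (rule plane)
  interpret valued_field_with_coefficient_field val t \<iota> by (rule valued)
  have val_F: "val (F $ x $ l) = Fin (if inc x l then 1 else 0)" for x l
    using lift by (simp add: rank_le_3_lift_def incidence_matrix_def)
  have Vtri_nth: "Vtri $ i $ j = V $ P i $ L j" for i j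
    by (simp add: Vtri selected_submatrix_def)
  \<comment> \<open>The diagonal positions are incidences, where \<open>F\<close> has valuation
    exactly \<open>1\<close>.\<close>
  have diag: "Vtri $ i $ i \<noteq> 0" for i
  proof -
    have "has_jet (F $ P i $ L i) (U $ P i $ L i) (V $ P i $ L i)"
      using expansion by (simp add: first_order_expansion_def has_jet_def)
    then show ?thesis
      unfolding Vtri_nth by (rule has_jet_linear_term_nonzero) (simp add: val_F lines(2))
  qed
  have "rank F \<le> 3"
    using lift by (simp add: rank_le_3_lift_def)
  then obtain a b where ab: "\<And>x l. V $ x $ l = (\<Sum>s\<in>{..<3::nat} <+> {..<3::nat}. a s x * b s l)"
    by (rule linear_term_rank_factorization[OF _ _ expansion]) (simp_all add: val_F)
  have "rank Vtri \<le> card ({..<3::nat} <+> {..<3::nat})"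
    by (rule rank_le_card_if_sum_rank_one) (simp_all add: Vtri_nth ab)
  then have rank: "rank Vtri \<le> 6"
    by (simp add: card_Plus)
  have edges: "real (card (support_graph_edges Vtri)) \<ge> real N * (real N - 6) / 12"
    using card_support_graph_edges_ge[OF diag rank] N(2) by simp
  have N_q: "real N * (real N - 6) / 12 = (real q + 1) * (real q - 5) / 12"
    by (simp add: N(1))
  \<comment> \<open>Otherwise \<open>P i\<close> and \<open>P j\<close> would both lie on
    \<open>L j\<close> and on \<open>lstar\<close>, forcing these lines to coincide.\<close>
  have nonincident: "\<not> inc (P i) (L j)" if "i \<noteq> j" for i j
  proof
    assume "inc (P i) (L j)"
    moreover have "P i \<noteq> P j"
      using that bij_betw_imp_inj_on[OF points] by (simp add: inj_eq)
    moreover have "inc (P k) lstar" for k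
      using bij_betwE[OF points] by simp
    ultimately show False
      using unique_line[of "P i" "P j"] lines by metis
  qed
  have "real (card {(i, j). i \<noteq> j \<and> V $ P i $ L j \<noteq> 0}) \<ge> real (card (support_graph_edges Vtri))"
    using card_support_graph_edges_le[of Vtri] by (simp add: Vtri_nth)
  then show ?thesis
    using diag rank edges N_q nonincident by auto
qed

end
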